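(* Let $e\ge1$ and let the cyclic group $C_e=\langle\rho\rangle$ act on $B=\mathbb C[x_1,x_2]$ by $\rho(x_1)=\epsilon x_1$, $\rho(x_2)=\epsilon^{-1}x_2$, $\epsilon=\exp(2\pi i/e)$. For $0\le i\le e-1$ let $N_i=A_1x_1^i+A_1x_2^{e-i}$, where $A_1=B^{C_e}=\mathbb C[x_1^e,x_2^e,x_1x_2]$. Then $$N_i^{ann}=\begin{cases}\mathbb Cx_1^i,&0\le i\le(e-1)/2,\\ \mathbb Cx_1^{e_1}+\mathbb Cx_2^{e_1},&i=e_1,\ \text{when }e=2e_1\text{ is even},\\ \mathbb Cx_2^{e-i},&e/2<i\le e-1.\end{cases}$$
   Context: $\mathcal D_B=\mathbb C\langle x_1,x_2,\partial_1,\partial_2\rangle$ is the Weyl algebra, graded by $\deg x_i=1$, $\deg\partial_i=-1$, with the induced action of $C_e$; $\mathcal D_1=\mathcal D_B^{C_e}$ and $\mathcal D_1^-$ is the sum of its parts of strictly negative degree. For a $\mathcal D_1$-submodule $N\subset B$, $N^{ann}=\{y\in N:\mathcal D_1^-y=0\}$. Each $N_i$ is a $\mathcal D_1$-submodule of $B$: it is the isotypic component of $B$ for the character $\rho\mapsto\epsilon^i$ of $C_e$. *)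

theory Defs
  imports
    "HOL-Analysis.Complex_Transcendental"
    "HOL-Number_Theory.Cong"
    "HOL-Computational_Algebra.Polynomial"
    "HOL-Library.Function_Algebras"
begin

text \<open>
  The ring \<open>B = \<complex>[x\<^sub>1, x\<^sub>2]\<close> is rendered as \<open>(\<complex>[x\<^sub>1])[x\<^sub>2]\<close>: the outer variable is \<open>x\<^sub>2\<close>, so the
  coefficient of \<open>x\<^sub>1\<^sup>a x\<^sub>2\<^sup>b\<close> in \<open>p\<close> is \<open>coeff (coeff p b) a\<close>.
\<close>

type_synonym B = "complex poly poly"

definition x1 :: B where "x1 = [:[:0, 1:]:]"

definition x2 :: B where "x2 = [:0, 1:]"

definition scaleB :: "complex \<Rightarrow> B \<Rightarrow> B" where
  "scaleB c p = smult [:c:] p"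

global_interpretation B: vector_space scaleB
proof
  show "scaleB 1 p = p" for p
    by (simp add: scaleB_def flip: one_pCons)
qed (simp_all add: scaleB_def smult_add_right mult.commute flip: smult_add_left)

definition d1 :: "B \<Rightarrow> B" where "d1 = map_poly pderiv"

definition d2 :: "B \<Rightarrow> B" where "d2 = pderiv"

text \<open>Operators on \<open>B\<close>; their pointwise sum is the one of \<^theory>\<open>HOL-Library.Function_Algebras\<close>.\<close>

definition scaleOp :: "complex \<Rightarrow> (B \<Rightarrow> B) \<Rightarrow> (B \<Rightarrow> B)" where
  "scaleOp c P = (\<lambda>p. scaleB c (P p))"

global_interpretation Op: vector_space scaleOp
  by unfold_locales
    (auto simp: scaleOp_def fun_eq_iff B.scale_right_distrib B.scale_left_distrib)

subsection \<open>The Weyl algebra and its grading\<close>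

text \<open>
  Over \<open>\<complex>\<close> the Weyl algebra acts faithfully on \<open>B\<close>, and it is taken to be the subalgebra of
  \<open>End\<^sub>\<complex> B\<close> generated by the multiplications by \<open>x\<^sub>1, x\<^sub>2\<close> and by \<open>\<partial>\<^sub>1, \<partial>\<^sub>2\<close>, i.e. the linear span of
  all words in these four generators.
\<close>

datatype gen = Gx1 | Gx2 | Gd1 | Gd2

primrec gen_op :: "gen \<Rightarrow> (B \<Rightarrow> B)" where
  "gen_op Gx1 = (\<lambda>p. x1 * p)"
| "gen_op Gx2 = (\<lambda>p. x2 * p)"
| "gen_op Gd1 = d1"
| "gen_op Gd2 = d2"

primrec gen_deg :: "gen \<Rightarrow> int" where
  "gen_deg Gx1 = 1"
| "gen_deg Gx2 = 1"
| "gen_deg Gd1 = -1"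
| "gen_deg Gd2 = -1"

definition word_op :: "gen list \<Rightarrow> (B \<Rightarrow> B)" where
  "word_op w = foldr (\<lambda>g P. gen_op g \<circ> P) w id"

definition word_deg :: "gen list \<Rightarrow> int" where
  "word_deg w = sum_list (map gen_deg w)"

definition weyl :: "(B \<Rightarrow> B) set" where
  "weyl = Op.span (range word_op)"

definition weyl_part :: "int \<Rightarrow> (B \<Rightarrow> B) set" where
  "weyl_part n = Op.span {word_op w | w. word_deg w = n}"

subsection \<open>The action of the cyclic group\<close>

definition eps :: "nat \<Rightarrow> complex" where
  "eps e = exp (2 * of_real pi * \<i> / of_nat e)"

text \<open>The substitution \<open>x\<^sub>1 \<mapsto> \<epsilon> x\<^sub>1\<close>, \<open>x\<^sub>2 \<mapsto> \<epsilon>\<^sup>-\<^sup>1 x\<^sub>2\<close>.\<close>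

definition rho :: "nat \<Rightarrow> B \<Rightarrow> B" where
  "rho e p = pcompose (map_poly (\<lambda>q. pcompose q [:0, eps e:]) p) [:0, [:inverse (eps e):]:]"

text \<open>The automorphisms of \<open>B\<close> given by the elements of \<open>C\<^sub>e\<close>, that is, the powers of \<open>\<rho>\<close>.\<close>

definition cyc :: "nat \<Rightarrow> (B \<Rightarrow> B) set" where
  "cyc e = range (\<lambda>k. rho e ^^ k)"

definition A1 :: "nat \<Rightarrow> B set" where
  "A1 e = {p. \<forall>g\<in>cyc e. g p = p}"

text \<open>On operators the induced action of \<open>g\<close> is \<open>P \<mapsto> g P g\<^sup>-\<^sup>1\<close>.\<close>

definition D1_alg :: "nat \<Rightarrow> (B \<Rightarrow> B) set" where
  "D1_alg e = {P \<in> weyl. \<forall>g\<in>cyc e. g \<circ> P \<circ> inv g = P}"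

definition D1_neg :: "nat \<Rightarrow> (B \<Rightarrow> B) set" where
  "D1_neg e = Op.span (\<Union>n\<in>{..<0}. D1_alg e \<inter> weyl_part n)"

definition ann :: "nat \<Rightarrow> B set \<Rightarrow> B set" where
  "ann e N = {y \<in> N. \<forall>P\<in>D1_neg e. P y = 0}"

definition N_mod :: "nat \<Rightarrow> nat \<Rightarrow> B set" where
  "N_mod e i = {a * x1 ^ i + b * x2 ^ (e - i) | a b. a \<in> A1 e \<and> b \<in> A1 e}"

subsection \<open>Basic facts\<close>

lemma coeff_rho:
  "coeff (coeff (rho e p) b) a = inverse (eps e) ^ b * eps e ^ a * coeff (coeff p b) a"
  by (simp add: rho_def coeff_pcompose_linear coeff_map_poly poly_const_pow)

lemma rho_x1: "rho e x1 = scaleB (eps e) x1"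
  by (intro poly_eqI) (auto simp: coeff_rho x1_def scaleB_def coeff_pCons split: nat.splits)

lemma rho_x2: "rho e x2 = scaleB (inverse (eps e)) x2"
  by (intro poly_eqI) (auto simp: coeff_rho x2_def scaleB_def coeff_pCons split: nat.splits)

lemma rho_add: "rho e (p + q) = rho e p + rho e q"
  by (intro poly_eqI) (simp add: coeff_rho algebra_simps)

lemma rho_scaleB: "rho e (scaleB c p) = scaleB c (rho e p)"
  by (intro poly_eqI) (simp add: coeff_rho scaleB_def)

lemma rho_mult: "rho e (p * q) = rho e p * rho e q"
proof -
  have "map_poly (\<lambda>r. pcompose r [:0, eps e:]) (p * q)
      = map_poly (\<lambda>r. pcompose r [:0, eps e:]) p * map_poly (\<lambda>r. pcompose r [:0, eps e:]) q"
    by (intro poly_eqI) (simp add: coeff_map_poly coeff_mult pcompose_sum pcompose_mult)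
  then show ?thesis
    by (simp add: rho_def pcompose_mult)
qed

lemma rho_power: "rho e (p ^ n) = rho e p ^ n"
proof (induction n)
  case 0
  have "rho e 1 = 1"
    by (simp add: rho_def pcompose_1 map_poly_1')
  then show ?case by simp
qed (simp add: rho_mult)

lemma mono_eq: "x1 ^ a * x2 ^ b = monom (monom 1 a) b"
proof -
  have x: "x1 = [:monom 1 1:]" "x2 = monom 1 1"
    by (simp_all add: x1_def x2_def monom_altdef)
  show ?thesis
    unfolding x by (simp add: poly_const_pow monom_power smult_monom)
qed

lemma B_decomp:
  "p = (\<Sum>b\<le>degree p. \<Sum>a\<le>degree (coeff p b). scaleB (coeff (coeff p b) a) (x1 ^ a * x2 ^ b))"
proof -
  have "p = (\<Sum>b\<le>degree p. monom (coeff p b) b)"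
    by (simp add: poly_as_sum_of_monoms)
  also have "\<dots> = (\<Sum>b\<le>degree p. monom (\<Sum>a\<le>degree (coeff p b). monom (coeff (coeff p b) a) a) b)"
    by (simp add: poly_as_sum_of_monoms)
  also have "\<dots> = (\<Sum>b\<le>degree p. \<Sum>a\<le>degree (coeff p b).
      scaleB (coeff (coeff p b) a) (x1 ^ a * x2 ^ b))"
    by (simp add: mono_eq scaleB_def smult_monom monom_sum)
  finally show ?thesis .
qed

lemma A1_iff: "p \<in> A1 e \<longleftrightarrow> rho e p = p"
proof
  assume "p \<in> A1 e"
  moreover have "rho e ^^ 1 \<in> cyc e"
    unfolding cyc_def by blast
  ultimately show "rho e p = p"
    by (auto simp: A1_def)
next
  assume "rho e p = p"
  then have "(rho e ^^ k) p = p" for k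
    by (induction k) auto
  then show "p \<in> A1 e"
    by (auto simp: A1_def cyc_def)
qed

lemma eps_pow_eq_iff:
  assumes "e \<ge> 1"
  shows "eps e ^ a = eps e ^ b \<longleftrightarrow> [a = b] (mod e)"
  using assms complex_root_unity_eq[of e a b]
  by (simp add: eps_def cong_def flip: exp_of_nat_mult) (simp add: mult_ac)

lemma rho_funpow_e:
  assumes "e \<ge> 1"
  shows "rho e ^^ e = id"
proof -
  have "coeff (coeff ((rho e ^^ k) p) b) a
      = (inverse (eps e) ^ k) ^ b * (eps e ^ k) ^ a * coeff (coeff p b) a" for k p a b
    by (induction k) (simp_all add: coeff_rho power_mult_distrib)
  moreover have "eps e ^ e = 1"
    using eps_pow_eq_iff[OF assms, of e 0] by (simp add: cong_def)
  ultimately show ?thesis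
    by (intro ext poly_eqI) (simp add: power_inverse)
qed

lemma bij_rho:
  assumes "e \<ge> 1"
  shows "bij (rho e)"
proof -
  obtain n where "e = Suc n"
    using assms by (cases e) auto
  then have "rho e ^^ Suc n = id"
    using rho_funpow_e[OF assms] by simp
  then show ?thesis
    by (intro o_bij[of "rho e ^^ n"]) (simp only: flip: funpow_Suc_right, simp only: flip: funpow.simps(2))
qed

text \<open>\<open>B\<^sup>C\<^sup>e\<close> is the subalgebra \<open>\<complex>[x\<^sub>1\<^sup>e, x\<^sub>2\<^sup>e, x\<^sub>1 x\<^sub>2]\<close>.\<close>

lemma A1_eq_generated:
  assumes e: "e \<ge> 1"
  shows "A1 e = B.span {(x1 ^ e) ^ j * (x2 ^ e) ^ k * (x1 * x2) ^ l | j k l. True}" (is "_ = B.span ?M")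
proof
  have eps0: "eps e \<noteq> 0"
    by (simp add: eps_def)
  have eps1: "eps e ^ e = 1"
    using eps_pow_eq_iff[OF e, of e 0] by (simp add: cong_def)
  show "B.span ?M \<subseteq> A1 e"
  proof (rule B.span_minimal)
    have "rho e (x1 ^ e) = x1 ^ e" "rho e (x2 ^ e) = x2 ^ e" "rho e (x1 * x2) = x1 * x2"
      using eps0 eps1
      by (simp_all add: rho_mult rho_power rho_x1 rho_x2 scaleB_def smult_power power_inverse
          poly_const_pow flip: one_pCons)
    then show "?M \<subseteq> A1 e"
      by (auto simp: A1_iff rho_mult rho_power)
    show "B.subspace (A1 e)"
      by (rule B.subspaceI) (auto simp: A1_iff rho_add rho_scaleB, simp add: rho_def)
  qed
  show "A1 e \<subseteq> B.span ?M"
  proof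
    fix p assume p: "p \<in> A1 e"
    have "scaleB (coeff (coeff p b) a) (x1 ^ a * x2 ^ b) \<in> B.span ?M" for a b
    proof (cases "coeff (coeff p b) a = 0")
      case False
      have "coeff (coeff (rho e p) b) a = coeff (coeff p b) a"
        using p by (simp add: A1_iff)
      with False eps0 have "eps e ^ a = eps e ^ b"
        by (simp add: coeff_rho power_inverse field_simps)
      then have cong: "[a = b] (mod e)"
        by (simp add: eps_pow_eq_iff[OF e])
      have "x1 ^ a * x2 ^ b \<in> ?M"
      proof (cases "a \<le> b")
        case True
        then obtain k where "b = a + e * k"
          using cong by (metis cong_le_nat mult.commute cong_sym add.commute)
        then have "x1 ^ a * x2 ^ b = (x1 ^ e) ^ 0 * (x2 ^ e) ^ k * (x1 * x2) ^ a"
          by (simp add: power_add power_mult power_mult_distrib mult_ac)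
        then show ?thesis by blast
      next
        case False
        then obtain k where "a = b + e * k"
          using cong by (metis cong_le_nat mult.commute add.commute nat_le_linear)
        then have "x1 ^ a * x2 ^ b = (x1 ^ e) ^ k * (x2 ^ e) ^ 0 * (x1 * x2) ^ b"
          by (simp add: power_add power_mult power_mult_distrib mult_ac)
        then show ?thesis by blast
      qed
      then show ?thesis
        by (intro B.span_scale B.span_base)
    qed (simp add: B.span_zero)
    then show "p \<in> B.span ?M"
      by (subst B_decomp[of p]) (intro B.span_sum)
  qed
qed

end

theory Submission
  imports Defs
begin

text \<open>
  A monomial \<open>x\<^sub>1\<^sup>a x\<^sub>2\<^sup>b\<close> spans the character \<open>\<rho> \<mapsto> \<epsilon>\<^sup>i\<close> exactly if \<open>a \<equiv> b + i\<close> modulo \<open>e\<close>, so \<open>N\<^sub>i\<close> only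
  contains such monomials.  An invariant operator commutes with \<open>\<rho>\<close> and hence preserves this
  congruence; if it has negative degree, it also lowers the total degree.  The congruence forces
  \<open>a \<ge> i\<close> or \<open>b \<ge> e - i\<close>, so nothing lies below total degree \<open>min i (e - i)\<close> and the monomials of that
  degree are annihilated: \<open>x\<^sub>1\<^sup>i\<close> if \<open>2 i \<le> e\<close>, and \<open>x\<^sub>2\<^sup>e\<^sup>-\<^sup>i\<close> if \<open>2 i \<ge> e\<close>
  (\<open>lowest_degree_in_ann\<close>).

  Conversely, a few monomial operators leave nothing else (\<open>ann_support\<close>).  Every monomial operator
  scales by a character under conjugation with \<open>\<rho>\<close>, which is trivial for
  \<open>\<partial>\<^sub>1 \<partial>\<^sub>2\<close>, \<open>\<partial>\<^sub>1\<^sup>e\<close> and \<open>\<partial>\<^sub>2\<^sup>e\<close>.  Being killed by the first removes all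
  mixed monomials, being killed by the other two bounds the exponents by \<open>e\<close>; at most the monomials
  \<open>x\<^sub>1\<^sup>i\<close> and \<open>x\<^sub>2\<^sup>e\<^sup>-\<^sup>i\<close> of \<open>N\<^sub>i\<close> are left.  If \<open>2 i < e\<close>, the operator \<open>x\<^sub>1\<^sup>i \<partial>\<^sub>2\<^sup>e\<^sup>-\<^sup>i\<close> is
  invariant, has the negative degree \<open>2 i - e\<close>, and excludes the second of them; if \<open>2 i > e\<close>, the
  operator \<open>x\<^sub>2\<^sup>e\<^sup>-\<^sup>i \<partial>\<^sub>1\<^sup>i\<close> excludes the first.
\<close>

section \<open>Isotypic components and homogeneous polynomials\<close>

definition isotypic :: "nat \<Rightarrow> nat \<Rightarrow> B set" where
  "isotypic e i = {p. rho e p = scaleB (eps e ^ i) p}"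

text \<open>The degree is an integer so that operators of negative degree can be applied freely.\<close>

definition homog :: "int \<Rightarrow> B set" where
  "homog d = {p. \<forall>a b. coeff (coeff p b) a \<noteq> 0 \<longrightarrow> int a + int b = d}"

lemma coeff_scaleB [simp]: "coeff (coeff (scaleB c p) b) a = c * coeff (coeff p b) a"
  by (simp add: scaleB_def)

lemma subspace_homog: "B.subspace (homog d)"
proof (rule B.subspaceI)
  show "p + q \<in> homog d" if "p \<in> homog d" "q \<in> homog d" for p q
  proof -
    have "coeff (coeff p b) a \<noteq> 0 \<or> coeff (coeff q b) a \<noteq> 0"
      if "coeff (coeff (p + q) b) a \<noteq> 0" for a b
      using that by auto
    with that show ?thesis
      unfolding homog_def by blast
  qed
qed (auto simp: homog_def)

lemma eps_nonzero [simp]: "eps e \<noteq> 0"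
  by (simp add: eps_def)

lemma eps_pow_e: "e \<ge> 1 \<Longrightarrow> eps e ^ e = 1"
  using eps_pow_eq_iff[of e e 0] by (simp add: cong_def)

lemma isotypic_support:
  assumes "e \<ge> 1" "p \<in> isotypic e i" "coeff (coeff p b) a \<noteq> 0"
  shows "[a = b + i] (mod e)"
proof -
  have "coeff (coeff (rho e p) b) a = coeff (coeff (scaleB (eps e ^ i) p) b) a"
    using assms(2) by (simp add: isotypic_def)
  with assms(3) have "eps e ^ a = eps e ^ (b + i)"
    by (simp add: coeff_rho power_inverse power_add field_simps)
  then show ?thesis
    using eps_pow_eq_iff[OF assms(1)] by blast
qed

text \<open>
  Write \<open>a - b - i\<close> as a multiple \<open>e k\<close>: the first alternative holds for \<open>k \<ge> 0\<close>, the second for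
  \<open>k \<le> -1\<close>.
\<close>

lemma isotypic_exponents:
  fixes a b i e :: nat
  assumes "[a = b + i] (mod e)"
  shows "i \<le> a \<or> e - i \<le> b"
proof -
  obtain k where k: "int a = int (b + i) + int e * k"
    using assms by (metis cong_iff_lin cong_int_iff cong_sym_eq mult.commute)
  show ?thesis
  proof (cases "k \<ge> 0")
    case True
    then have "int e * k \<ge> 0" by simp
    with k show ?thesis by linarith
  next
    case False
    then have "int e * k \<le> int e * (- 1)"
      by (intro mult_left_mono) auto
    with k show ?thesis by linarith
  qed
qed

lemma mem_span_if_support:
  assumes "\<And>a b. coeff (coeff p b) a \<noteq> 0 \<Longrightarrow> x1 ^ a * x2 ^ b \<in> V"
  shows "p \<in> B.span V"
proof -
  have "scaleB (coeff (coeff p b) a) (x1 ^ a * x2 ^ b) \<in> B.span V" for a b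
    by (cases "coeff (coeff p b) a = 0")
      (auto intro: B.span_scale B.span_base B.span_zero assms)
  then show ?thesis
    by (subst B_decomp[of p]) (intro B.span_sum)
qed

lemma rho_x1_pow: "rho e (x1 ^ i) = scaleB (eps e ^ i) (x1 ^ i)"
  by (simp add: rho_power rho_x1 scaleB_def smult_power poly_const_pow)

lemma rho_x2_pow:
  assumes "e \<ge> 1" "i \<le> e"
  shows "rho e (x2 ^ (e - i)) = scaleB (eps e ^ i) (x2 ^ (e - i))"
proof -
  have "eps e ^ (e - i) * eps e ^ i = 1"
    using assms by (simp add: eps_pow_e flip: power_add)
  then have "inverse (eps e) ^ (e - i) = eps e ^ i"
    by (simp add: power_inverse inverse_unique)
  then show ?thesis
    by (simp add: rho_power rho_x2 scaleB_def smult_power poly_const_pow)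
qed

lemma N_mod_subset_isotypic:
  assumes "e \<ge> 1" "i \<le> e"
  shows "N_mod e i \<subseteq> isotypic e i"
  using assms
  by (auto simp: N_mod_def isotypic_def A1_iff rho_add rho_mult rho_x1_pow rho_x2_pow scaleB_def
      smult_add_right)

lemma A1_0: "0 \<in> A1 e" and A1_1: "1 \<in> A1 e"
  using rho_power[of e 1 0] by (auto simp: A1_iff rho_def)

lemma x1_pow_in_N_mod: "x1 ^ i \<in> N_mod e i" and x2_pow_in_N_mod: "x2 ^ (e - i) \<in> N_mod e i"
proof -
  have "x1 ^ i = 1 * x1 ^ i + 0 * x2 ^ (e - i)" "x2 ^ (e - i) = 0 * x1 ^ i + 1 * x2 ^ (e - i)"
    by simp_all
  with A1_0[of e] A1_1[of e] show "x1 ^ i \<in> N_mod e i" "x2 ^ (e - i) \<in> N_mod e i"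
    unfolding N_mod_def by blast+
qed

lemma subspace_N_mod: "B.subspace (N_mod e i)"
proof (rule B.subspaceI)
  show "0 \<in> N_mod e i"
    using A1_0[of e] unfolding N_mod_def by force
  show "p + q \<in> N_mod e i" if "p \<in> N_mod e i" "q \<in> N_mod e i" for p q
  proof -
    from that obtain a b a' b' where
      *: "p = a * x1 ^ i + b * x2 ^ (e - i)" "q = a' * x1 ^ i + b' * x2 ^ (e - i)"
      "a \<in> A1 e" "b \<in> A1 e" "a' \<in> A1 e" "b' \<in> A1 e"
      unfolding N_mod_def by blast
    then have "p + q = (a + a') * x1 ^ i + (b + b') * x2 ^ (e - i)"
      by (simp add: algebra_simps)
    moreover have "a + a' \<in> A1 e" "b + b' \<in> A1 e"
      using * by (simp_all add: A1_iff rho_add)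
    ultimately show ?thesis
      unfolding N_mod_def by blast
  qed
  show "scaleB c p \<in> N_mod e i" if "p \<in> N_mod e i" for c p
  proof -
    from that obtain a b where
      *: "p = a * x1 ^ i + b * x2 ^ (e - i)" "a \<in> A1 e" "b \<in> A1 e"
      unfolding N_mod_def by blast
    then have "scaleB c p = scaleB c a * x1 ^ i + scaleB c b * x2 ^ (e - i)"
      by (simp add: scaleB_def smult_add_right)
    moreover have "scaleB c a \<in> A1 e" "scaleB c b \<in> A1 e"
      using * by (simp_all add: A1_iff rho_scaleB)
    ultimately show ?thesis
      unfolding N_mod_def by blast
  qed
qed

section \<open>Words in the generators of the Weyl algebra\<close>

lemma coeff_d1: "coeff (coeff (d1 p) b) a = of_nat (Suc a) * coeff (coeff p b) (Suc a)"
  by (simp add: d1_def coeff_map_poly coeff_pderiv)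

lemma coeff_d2: "coeff (coeff (d2 p) b) a = of_nat (Suc b) * coeff (coeff p (Suc b)) a"
  by (simp add: d2_def coeff_pderiv of_nat_poly del: of_nat_Suc)

lemma coeff_x1_mult:
  "coeff (coeff (x1 * p) b) a = (case a of 0 \<Rightarrow> 0 | Suc k \<Rightarrow> coeff (coeff p b) k)"
  by (simp add: x1_def coeff_pCons)

lemma coeff_x2_mult:
  "coeff (coeff (x2 * p) b) a = (case b of 0 \<Rightarrow> 0 | Suc k \<Rightarrow> coeff (coeff p k) a)"
  by (simp add: x2_def coeff_pCons split: nat.split)

lemmas coeff_gen_op = coeff_d1 coeff_d2 coeff_x1_mult coeff_x2_mult

lemma word_op_Nil [simp]: "word_op [] = id"
  and word_op_Cons [simp]: "word_op (g # w) = gen_op g \<circ> word_op w"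
  by (simp_all add: word_op_def)

lemma word_op_append: "word_op (v @ w) = word_op v \<circ> word_op w"
  by (induction v) (simp_all add: comp_assoc)

lemma word_op_replicate: "word_op (replicate n g) = gen_op g ^^ n"
  by (induction n) simp_all

lemma word_deg_append [simp]: "word_deg (v @ w) = word_deg v + word_deg w"
  by (simp add: word_deg_def)

lemma word_deg_replicate [simp]: "word_deg (replicate n g) = int n * gen_deg g"
  by (simp add: word_deg_def sum_list_replicate)

lemma gen_op_scaleB: "gen_op g (scaleB c p) = scaleB c (gen_op g p)"
  by (cases g; intro poly_eqI) (auto simp: coeff_gen_op split: nat.split)

lemma word_op_scaleB: "word_op w (scaleB c p) = scaleB c (word_op w p)"
  by (induction w) (simp_all add: gen_op_scaleB)

lemma gen_op_homog: "p \<in> homog d \<Longrightarrow> gen_op g p \<in> homog (gen_deg g + d)"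
  by (cases g) (fastforce simp: homog_def coeff_gen_op split: nat.splits)+

lemma word_op_homog: "p \<in> homog d \<Longrightarrow> word_op w p \<in> homog (word_deg w + d)"
proof (induction w)
  case (Cons g w)
  then show ?case
    using gen_op_homog[of "word_op w p" "word_deg w + d" g] by (simp add: word_deg_def add_ac)
qed (simp add: word_deg_def)

lemma weyl_scaleB:
  assumes "P \<in> weyl"
  shows "P (scaleB c p) = scaleB c (P p)"
  using assms unfolding weyl_def
proof (induction rule: Op.span_induct)
  case base
  show ?case
    by (rule Op.subspaceI)
      (auto simp: scaleOp_def B.scale_right_distrib mult.commute)
next
  case (step P)
  then show ?case by (auto simp: word_op_scaleB)
qed

lemma weyl_part_homog:
  assumes "P \<in> weyl_part n" "p \<in> homog d"
  shows "P p \<in> homog (n + d)"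
  using assms(1) unfolding weyl_part_def
proof (induction rule: Op.span_induct)
  case base
  show ?case
    using subspace_homog[of "n + d"]
    by (intro Op.subspaceI) (auto simp: scaleOp_def B.subspace_def)
next
  case (step P)
  then show ?case using word_op_homog[OF assms(2)] by auto
qed

text \<open>The character by which \<open>\<rho>\<close> acts on a generator, and hence on a word, by conjugation.\<close>

primrec gen_char :: "nat \<Rightarrow> gen \<Rightarrow> complex" where
  "gen_char e Gx1 = eps e"
| "gen_char e Gx2 = inverse (eps e)"
| "gen_char e Gd1 = inverse (eps e)"
| "gen_char e Gd2 = eps e"

definition word_char :: "nat \<Rightarrow> gen list \<Rightarrow> complex" where
  "word_char e w = prod_list (map (gen_char e) w)"

lemma word_char_append [simp]: "word_char e (v @ w) = word_char e v * word_char e w"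
  by (simp add: word_char_def)

lemma word_char_replicate [simp]: "word_char e (replicate n g) = gen_char e g ^ n"
  by (simp add: word_char_def prod_list_replicate)

lemma rho_gen_op: "rho e (gen_op g p) = scaleB (gen_char e g) (gen_op g (rho e p))"
  by (cases g; intro poly_eqI) (auto simp: coeff_gen_op coeff_rho split: nat.split)

lemma rho_word_op: "rho e (word_op w p) = scaleB (word_char e w) (word_op w (rho e p))"
  by (induction w) (simp_all add: word_char_def rho_gen_op gen_op_scaleB)

section \<open>Invariant operators of negative degree\<close>

lemma D1_alg_iff:
  assumes "e \<ge> 1"
  shows "P \<in> D1_alg e \<longleftrightarrow> P \<in> weyl \<and> (\<forall>p. rho e (P p) = P (rho e p))"
proof -
  have bij: "bij (rho e ^^ k)" for k
    using bij_rho[OF assms] by (rule bij_fn)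
  have conj_iff: "g \<circ> P \<circ> inv g = P \<longleftrightarrow> (\<forall>p. g (P p) = P (g p))" if "bij g" for g
    using bij_is_inj[OF that] bij_is_surj[OF that]
    by (auto simp: fun_eq_iff) (metis inv_f_f, metis surj_f_inv_f)
  have pow: "(rho e ^^ k) (P p) = P ((rho e ^^ k) p)" if "\<forall>p. rho e (P p) = P (rho e p)" for k p
    using that by (induction k) simp_all
  have "P \<in> D1_alg e \<longleftrightarrow> P \<in> weyl \<and> (\<forall>k p. (rho e ^^ k) (P p) = P ((rho e ^^ k) p))"
    using conj_iff[OF bij] by (auto simp: D1_alg_def cyc_def)
  also have "(\<forall>k p. (rho e ^^ k) (P p) = P ((rho e ^^ k) p)) \<longleftrightarrow> (\<forall>p. rho e (P p) = P (rho e p))"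
    using pow by (metis funpow_0 funpow_simps_right(2) o_apply)
  finally show ?thesis .
qed

lemma word_in_D1_neg:
  assumes "e \<ge> 1" "word_char e w = 1" "word_deg w < 0"
  shows "word_op w \<in> D1_neg e"
proof -
  have "word_op w \<in> D1_alg e"
    using assms(2) by (auto simp: D1_alg_iff[OF assms(1)] weyl_def rho_word_op intro: Op.span_base)
  moreover have "word_op w \<in> weyl_part (word_deg w)"
    unfolding weyl_part_def by (blast intro: Op.span_base)
  ultimately show ?thesis
    using assms(3) unfolding D1_neg_def by (blast intro: Op.span_base)
qed

lemma D1_neg_annihilates:
  assumes "P \<in> D1_neg e"
    and "\<And>n Q. n < 0 \<Longrightarrow> Q \<in> D1_alg e \<Longrightarrow> Q \<in> weyl_part n \<Longrightarrow> Q y = 0"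
  shows "P y = 0"
  using assms(1) unfolding D1_neg_def
proof (induction rule: Op.span_induct)
  case base
  show ?case by (rule Op.subspaceI) (auto simp: scaleOp_def)
next
  case (step P)
  then show ?case using assms(2) by auto
qed

text \<open>
  The image of \<open>y\<close> under an invariant operator of degree \<open>n < 0\<close> is isotypic for the same character
  and homogeneous of a degree too small for any monomial of that character.
\<close>

lemma lowest_degree_in_ann:
  assumes "e \<ge> 1" "i \<le> e" "y \<in> N_mod e i" "y \<in> homog (min (int i) (int (e - i)))"
  shows "y \<in> ann e (N_mod e i)"
proof -
  have y: "y \<in> isotypic e i"
    using N_mod_subset_isotypic[OF assms(1,2)] assms(3) by blast
  have "P y = 0" if "P \<in> D1_neg e" for P
    using that
  proof (rule D1_neg_annihilates)
    fix n Q assume Q: "n < (0::int)" "Q \<in> D1_alg e" "Q \<in> weyl_part n"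
    have "rho e (Q y) = Q (rho e y)"
      using Q(2) D1_alg_iff[OF assms(1)] by blast
    also have "\<dots> = Q (scaleB (eps e ^ i) y)"
      using y by (simp add: isotypic_def)
    also have "\<dots> = scaleB (eps e ^ i) (Q y)"
      using Q(2) by (simp add: D1_alg_iff[OF assms(1)] weyl_scaleB)
    finally have iso: "Q y \<in> isotypic e i"
      by (simp add: isotypic_def)
    have hom: "Q y \<in> homog (n + min (int i) (int (e - i)))"
      using weyl_part_homog[OF Q(3) assms(4)] .
    have "coeff (coeff (Q y) b) a = 0" for a b
    proof (rule ccontr)
      assume nz: "coeff (coeff (Q y) b) a \<noteq> 0"
      have "i \<le> a \<or> e - i \<le> b"
        using isotypic_exponents[OF isotypic_support[OF assms(1) iso nz]] .
      moreover have "int a + int b = n + min (int i) (int (e - i))"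
        using hom nz by (simp add: homog_def)
      ultimately show False
        using Q(1) by linarith
    qed
    then show "Q y = 0"
      by (intro poly_eqI) simp
  qed
  with assms(3) show ?thesis
    by (simp add: ann_def)
qed

section \<open>The support of annihilated elements\<close>

lemma coeff_d1_funpow_eq_0_iff:
  "coeff (coeff ((d1 ^^ k) p) b) a = 0 \<longleftrightarrow> coeff (coeff p b) (a + k) = 0"
  by (induction k arbitrary: a) (simp_all add: coeff_d1 del: of_nat_Suc)

lemma coeff_d2_funpow_eq_0_iff:
  "coeff (coeff ((d2 ^^ k) p) b) a = 0 \<longleftrightarrow> coeff (coeff p (b + k)) a = 0"
  by (induction k arbitrary: b) (simp_all add: coeff_d2 del: of_nat_Suc)

lemma mult_pow_funpow: "((\<lambda>p. x * p) ^^ n) (p :: 'a :: monoid_mult) = x ^ n * p"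
  by (induction n) (simp_all add: mult.assoc)

text \<open>
  For \<open>m = 0\<close> these cover the pure powers \<open>\<partial>\<^sub>1\<^sup>n\<close> and \<open>\<partial>\<^sub>2\<^sup>n\<close>.  The factor \<open>x\<^sub>2\<^sup>m\<close> or \<open>x\<^sub>1\<^sup>m\<close>, whose
  role is to make the operator invariant, is harmless because \<open>B\<close> is a domain.
\<close>

lemma ann_x1_exponent_less:
  assumes "e \<ge> 1" "m < n" "m + n = e" "y \<in> ann e N" "coeff (coeff y b) a \<noteq> 0"
  shows "a < n"
proof (rule ccontr)
  assume "\<not> a < n"
  then obtain k where k: "a = k + n"
    by (metis add.commute le_Suc_ex not_le)
  let ?w = "replicate m Gx2 @ replicate n Gd1"
  have "inverse (eps e) ^ (m + n) = 1"
    using assms(1,3) by (simp add: eps_pow_e power_inverse)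
  then have "inverse (eps e) ^ m * inverse (eps e) ^ n = 1"
    by (simp only: power_add)
  then have "word_op ?w \<in> D1_neg e"
    using assms(1,2) by (intro word_in_D1_neg) simp_all
  then have "x2 ^ m * (d1 ^^ n) y = 0"
    using assms(4) by (auto simp: ann_def word_op_append word_op_replicate mult_pow_funpow)
  then have "(d1 ^^ n) y = 0"
    by (auto simp: x2_def)
  then show False
    using assms(5) coeff_d1_funpow_eq_0_iff[of n y b k] by (simp add: k)
qed

lemma ann_x2_exponent_less:
  assumes "e \<ge> 1" "m < n" "m + n = e" "y \<in> ann e N" "coeff (coeff y b) a \<noteq> 0"
  shows "b < n"
proof (rule ccontr)
  assume "\<not> b < n"
  then obtain k where k: "b = k + n"
    by (metis add.commute le_Suc_ex not_le)
  let ?w = "replicate m Gx1 @ replicate n Gd2"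
  have "eps e ^ m * eps e ^ n = 1"
    using assms(1,3) by (simp add: eps_pow_e flip: power_add)
  then have "word_op ?w \<in> D1_neg e"
    using assms(1,2) by (intro word_in_D1_neg) simp_all
  then have "x1 ^ m * (d2 ^^ n) y = 0"
    using assms(4) by (auto simp: ann_def word_op_append word_op_replicate mult_pow_funpow)
  then have "(d2 ^^ n) y = 0"
    by (auto simp: x1_def)
  then show False
    using assms(5) coeff_d2_funpow_eq_0_iff[of n y k a] by (simp add: k)
qed

lemma ann_no_mixed_monomial:
  assumes "e \<ge> 1" "y \<in> ann e N" "coeff (coeff y b) a \<noteq> 0"
  shows "a = 0 \<or> b = 0"
proof (rule ccontr)
  assume "\<not> (a = 0 \<or> b = 0)"
  then obtain k l where kl: "a = Suc k" "b = Suc l"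
    by (auto simp: gr0_conv_Suc)
  have "word_op [Gd1, Gd2] \<in> D1_neg e"
    using assms(1) by (intro word_in_D1_neg) (simp_all add: word_char_def word_deg_def)
  then have "d1 (d2 y) = 0"
    using assms(2) by (auto simp: ann_def)
  then have "coeff (coeff (d1 (d2 y)) l) k = 0"
    by simp
  then show False
    using assms(3) by (simp add: kl coeff_d1 coeff_d2 del: of_nat_Suc)
qed

lemma ann_support:
  assumes "e \<ge> 1" "i < e" "y \<in> ann e (N_mod e i)" "coeff (coeff y b) a \<noteq> 0"
  shows "2 * i \<le> e \<and> a = i \<and> b = 0 \<or> e \<le> 2 * i \<and> a = 0 \<and> b = e - i"
proof -
  have "y \<in> isotypic e i"
    using assms N_mod_subset_isotypic[of e i] by (auto simp: ann_def)
  then have cong: "[a = b + i] (mod e)"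
    using isotypic_support assms by blast
  have "a < e"
    by (rule ann_x1_exponent_less[OF assms(1) _ _ assms(3,4), of 0]) (use assms(1) in simp_all)
  have "b < e"
    by (rule ann_x2_exponent_less[OF assms(1) _ _ assms(3,4), of 0]) (use assms(1) in simp_all)
  have "a < i" if "e < 2 * i"
    by (rule ann_x1_exponent_less[OF assms(1) _ _ assms(3,4), of "e - i"])
      (use that assms(2) in linarith)+
  moreover have "b < e - i" if "2 * i < e"
    by (rule ann_x2_exponent_less[OF assms(1) _ _ assms(3,4), of i])
      (use that assms(2) in linarith)+
  moreover have "a = i" if "b = 0"
    using cong \<open>a < e\<close> assms(2) that by (auto intro: cong_less_modulus_unique_nat)
  \<comment> \<open>Here \<open>e\<close> divides \<open>b + i < 2 e\<close>, which leaves the values \<open>0\<close> and \<open>e\<close>.\<close>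
  moreover have "b + i = 0 \<or> b + i = e" if "a = 0"
  proof -
    have "e dvd b + i"
      using cong_sym[OF cong] that by (simp add: cong_0_iff)
    then obtain k where k: "b + i = e * k" ..
    with \<open>b < e\<close> assms(2) have "e * k < e * 2"
      by linarith
    then have "k = 0 \<or> k = 1"
      by auto
    with k show ?thesis by auto
  qed
  moreover have "a = 0 \<or> b = 0"
    using ann_no_mixed_monomial assms by blast
  ultimately show ?thesis
    by linarith
qed

lemma x1_pow_homog: "x1 ^ i \<in> homog (int i)"
  and x2_pow_homog: "x2 ^ i \<in> homog (int i)"
  using mono_eq[of i 0] mono_eq[of 0 i] by (auto simp: homog_def coeff_monom split: if_splits)

text \<open>
  The lowest degree part of \<open>N\<^sub>i\<close>, whose two spanning monomials coexist exactly for \<open>e = 2 i\<close>.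
\<close>

lemma ann_N_mod:
  assumes "e \<ge> 1" "i < e"
  shows "ann e (N_mod e i)
    = B.span ({p. 2 * i \<le> e \<and> p = x1 ^ i} \<union> {p. e \<le> 2 * i \<and> p = x2 ^ (e - i)})" (is "_ = B.span ?M")
proof
  show "ann e (N_mod e i) \<subseteq> B.span ?M"
  proof
    fix y assume "y \<in> ann e (N_mod e i)"
    then show "y \<in> B.span ?M"
      using ann_support[OF assms] by (intro mem_span_if_support) fastforce
  qed
  let ?d = "min (int i) (int (e - i))"
  have "x1 ^ i \<in> homog ?d" if "2 * i \<le> e"
    using x1_pow_homog[of i] that by (simp add: min_absorb1)
  moreover have "x2 ^ (e - i) \<in> homog ?d" if "e \<le> 2 * i"
  proof -
    have "?d = int (e - i)"
      using that by (intro min_absorb2) linarith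
    then show ?thesis
      using x2_pow_homog[of "e - i"] by simp
  qed
  ultimately have "?M \<subseteq> N_mod e i \<inter> homog ?d"
    using x1_pow_in_N_mod[of i e] x2_pow_in_N_mod[of e i] by auto
  then have "B.span ?M \<subseteq> N_mod e i \<inter> homog ?d"
    by (intro B.span_minimal B.subspace_inter subspace_N_mod subspace_homog)
  then show "B.span ?M \<subseteq> ann e (N_mod e i)"
    using assms lowest_degree_in_ann[of e i] by auto
qed

theorem proposition6p2:
  fixes e i :: nat
  assumes "e \<ge> 1" and "i \<le> e - 1"
  shows "(real i \<le> (real e - 1) / 2 \<longrightarrow> ann e (N_mod e i) = B.span {x1 ^ i})
    \<and> (\<forall>e1. e = 2 * e1 \<and> i = e1 \<longrightarrow> ann e (N_mod e i) = B.span {x1 ^ e1, x2 ^ e1})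
    \<and> (real e / 2 < real i \<longrightarrow> ann e (N_mod e i) = B.span {x2 ^ (e - i)})"
proof -
  have "i < e"
    using assms by linarith
  note ann = ann_N_mod[OF assms(1) this]
  show ?thesis
  proof (intro conjI allI impI)
    assume "real i \<le> (real e - 1) / 2"
    then have "real (2 * i) < real e" by simp
    then have "2 * i < e" by (simp only: of_nat_less_iff)
    then show "ann e (N_mod e i) = B.span {x1 ^ i}"
      unfolding ann by simp
  next
    fix e1 assume "e = 2 * e1 \<and> i = e1"
    then show "ann e (N_mod e i) = B.span {x1 ^ e1, x2 ^ e1}"
      unfolding ann by (simp add: insert_commute)
  next
    assume "real e / 2 < real i"
    then have "real e < real (2 * i)" by simp
    then have "e < 2 * i" by (simp only: of_nat_less_iff)
    then show "ann e (N_mod e i) = B.span {x2 ^ (e - i)}"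
      unfolding ann by simp
  qed
qed

end
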